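(* Let $D=D[0,1]$ be the space of real functions on $[0,1]$ that are right-continuous and have left-hand limits, let $T\subset[0,1]$ be a fixed countable dense subset, let $\tau$ be a regular metric on $D$ (with respect to $T$), and let $\mathcal{B}_\tau$ be the Borel $\sigma$-field of $(D,\tau)$. Then every tight sequence $(\mu_n)$ of probability measures on $\mathcal{B}_\tau$ admits a weakly convergent subsequence.
   Context: For $t\in[0,1]$, $x(t-)$ denotes the left-hand limit of $x\in D$ at $t$ (with $x(0-)=x(0)$), and $t^*$ stands for either $t$ or $t-$. For $t_1,\dots,t_k\in[0,1]$ define $\pi_{t_1^*,\dots,t_k^*}:D\to\mathbb{R}^k$ by $\pi_{t_1^*,\dots,t_k^*}x=(x(t_1^* ),\dots,x(t_k^* ))$. For $x\in D$ let $\pi_{[t]}(\{x\})=\{x(t),x(t-)\}\subset\mathbb{R}$ and $\pi_{[t_1,\dots,t_k]}(\{x\})=\prod_{i=1}^k\pi_{[t_i]}(\{x\})\subset\mathbb{R}^k$, and for $A\subset D$ let $\pi_{[t_1,\dots,t_k]}A=\bigcup_{x\in A}\pi_{[t_1,\dots,t_k]}(\{x\})$. A metric $\tau$ on $D$, with Borel $\sigma$-field $\mathcal{B}_\tau$, is called regular if: (a) for every $k\ge 1$ and every choice of $t_1,\dots,t_k$ in $[0,1]$: (i) all the maps $\pi_{t_1^*,\dots,t_k^*}$ are $\mathcal{B}_\tau$-measurable, and (ii) for every compact set $K\subset(D,\tau)$, $\pi_{[t_1,\dots,t_k]}K$ is a closed subset of $\mathbb{R}^k$; and (b) $\tau(x_n,x)\to0$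 implies that, for every $t\in T$, the set of limit points of each of the two sequences $(x_n(t))$ and $(x_n(t-))$ is contained in $\{x(t),x(t-)\}$. A sequence $(\mu_n)$ of probability measures on $\mathcal{B}_\tau$ is tight if for every $\varepsilon>0$ there is a compact set $K_\varepsilon\subset(D,\tau)$ with $\mu_n(K_\varepsilon)>1-\varepsilon$ for all $n$. Probability measures $\nu_n$ on $\mathcal{B}_\tau$ converge weakly to a probability measure $\nu$ on $\mathcal{B}_\tau$ if $\limsup_{n\to\infty}\nu_n(C)\le\nu(C)$ for every $\tau$-closed set $C\subset D$. *)

theory Defs
  imports "HOL-Probability.Probability"
begin

text \<open>
  Functions on the unit interval are extensional functions of type \<open>real \<Rightarrow> real\<close>, so that HOL
  equality of members of \<open>cadlag\<close> is equality of functions on \<open>[0,1]\<close>.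
  The one-sided filters only look at points of \<open>[0,1]\<close> near \<open>t\<close>, because \<open>t = 1\<close>
  is left out of the first condition and \<open>t = 0\<close> out of the second.
\<close>

definition cadlag :: "(real \<Rightarrow> real) set" where
  "cadlag = {x \<in> extensional {0..1}.
     (\<forall>t\<in>{0..<1}. (x \<longlongrightarrow> x t) (at_right t)) \<and>
     (\<forall>t\<in>{0<..1}. \<exists>l. (x \<longlongrightarrow> l) (at_left t))}"

definition left_limit :: "(real \<Rightarrow> real) \<Rightarrow> real \<Rightarrow> real" where
  "left_limit x t = (if t = 0 then x 0 else Lim (at_left t) x)"

lemma tendsto_left_limit:
  assumes "x \<in> cadlag" "0 < t" "t \<le> 1"
  shows "(x \<longlongrightarrow> left_limit x t) (at_left t)"
proof -
  obtain l where l: "(x \<longlongrightarrow> l) (at_left t)"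
    using assms unfolding cadlag_def by force
  then have "Lim (at_left t) x = l"
    by (intro tendsto_Lim) simp_all
  with l assms(2) show ?thesis
    by (simp add: left_limit_def)
qed

text \<open>
  Points of \<open>\<real>\<^sup>k\<close> are extensional functions on \<open>{..<k}\<close>. The flag \<open>s i\<close> selects
  the reading of \<open>t\<^sub>i\<^sup>*\<close>: \<open>t\<^sub>i-\<close> if it is true, and \<open>t\<^sub>i\<close> otherwise.
\<close>

definition proj_star ::
  "nat \<Rightarrow> (nat \<Rightarrow> real) \<Rightarrow> (nat \<Rightarrow> bool) \<Rightarrow> (real \<Rightarrow> real) \<Rightarrow> nat \<Rightarrow> real" where
  "proj_star k t s x = (\<lambda>i\<in>{..<k}. if s i then left_limit x (t i) else x (t i))"

definition proj_box :: "nat \<Rightarrow> (nat \<Rightarrow> real) \<Rightarrow> (real \<Rightarrow> real) set \<Rightarrow> (nat \<Rightarrow> real) set" where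
  "proj_box k t A = (\<Union>x\<in>A. \<Pi>\<^sub>E i\<in>{..<k}. {x (t i), left_limit x (t i)})"

definition borel_measure_of :: "'a metric \<Rightarrow> 'a measure" where
  "borel_measure_of \<tau> = sigma (mspace \<tau>) {U. openin (mtopology_of \<tau>) U}"

definition seq_limit_points :: "(nat \<Rightarrow> real) \<Rightarrow> real set" where
  "seq_limit_points a = {l. \<exists>r. strict_mono r \<and> (a \<circ> r) \<longlonglongrightarrow> l}"

definition regular_metric :: "real set \<Rightarrow> (real \<Rightarrow> real) metric \<Rightarrow> bool" where
  "regular_metric T \<tau> \<longleftrightarrow>
     mspace \<tau> = cadlag \<and>
     (\<forall>k\<ge>1. \<forall>t. (\<forall>i<k. t i \<in> {0..1}) \<longrightarrow>
        (\<forall>s. proj_star k t s \<in> borel_measure_of \<tau> \<rightarrow>\<^sub>M (\<Pi>\<^sub>M i\<in>{..<k}. borel)) \<and>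
        (\<forall>K. compactin (mtopology_of \<tau>) K \<longrightarrow>
           closedin (product_topology (\<lambda>i. euclidean) {..<k}) (proj_box k t K))) \<and>
     (\<forall>X x. (\<forall>n. X n \<in> cadlag) \<and> x \<in> cadlag \<and> (\<lambda>n. mdist \<tau> (X n) x) \<longlonglongrightarrow> 0 \<longrightarrow>
        (\<forall>t\<in>T. seq_limit_points (\<lambda>n. X n t) \<subseteq> {x t, left_limit x t} \<and>
               seq_limit_points (\<lambda>n. left_limit (X n) t) \<subseteq> {x t, left_limit x t}))"

definition borel_prob_measures :: "'a metric \<Rightarrow> 'a measure set" where
  "borel_prob_measures \<tau> = {M. prob_space M \<and> sets M = sets (borel_measure_of \<tau>)}"

definition tight_sequence :: "'a metric \<Rightarrow> (nat \<Rightarrow> 'a measure) \<Rightarrow> bool" where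
  "tight_sequence \<tau> \<mu> \<longleftrightarrow>
     (\<forall>\<epsilon>>0. \<exists>K. compactin (mtopology_of \<tau>) K \<and> (\<forall>n. measure (\<mu> n) K > 1 - \<epsilon>))"

definition weakly_converges :: "'a metric \<Rightarrow> (nat \<Rightarrow> 'a measure) \<Rightarrow> 'a measure \<Rightarrow> bool" where
  "weakly_converges \<tau> N \<nu> \<longleftrightarrow>
     (\<forall>C. closedin (mtopology_of \<tau>) C \<longrightarrow> limsup (\<lambda>n. emeasure (N n) C) \<le> emeasure \<nu> C)"

end

(* This is the direct half of Prokhorov's theorem, which holds in every metric space. Let K_0, K_1, ... be increasing compact
   sets that exhaust the mass uniformly. Countably many open sets form a base of the topology at
   all points of the K_u; a diagonal argument makes the measures converge on all finite unions H of
   sets (closure of A) Int K_u with A in that base. Calling the limits alpha(H), put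
   beta(G) = sup {alpha(H) | H <= G} for open G and gamma(S) = inf {beta(G) | S <= G}. Then gamma is
   an outer measure (Billingsley), closed sets are Caratheodory measurable, and the restriction of
   gamma to the Borel sets is the weak limit. *)

theory Submission
  imports Defs "HOL-Complex_Analysis.Great_Picard"
begin

section \<open>Compact cells, their finite unions and the set functions built on them\<close>

locale exhausted_sequence =
  fixes X :: "'a topology" and \<A> :: "'a set set" and K :: "nat \<Rightarrow> 'a set"
    and \<mu> :: "nat \<Rightarrow> 'a measure"
  assumes Hausdorff: "Hausdorff_space X"
    and open_base: "\<And>A. A \<in> \<A> \<Longrightarrow> openin X A"
    and base: "\<And>G x u. openin X G \<Longrightarrow> x \<in> G \<Longrightarrow> x \<in> K u \<Longrightarrow>
      \<exists>A\<in>\<A>. x \<in> A \<and> X closure_of A \<subseteq> G"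
    and compact_K: "\<And>u. compactin X (K u)"
    and incseq_K: "incseq K"
    and prob_space_\<mu>: "\<And>n. prob_space (\<mu> n)"
    and sets_\<mu>: "\<And>n. sets (\<mu> n) = sets (sigma (topspace X) {U. openin X U})"
begin

text \<open>The closure of a base set need not be compact; cutting it with \<open>K u\<close> makes
  it so, and the result is closed, hence Borel, because the space is Hausdorff.\<close>

definition cells :: "'a set set" where
  "cells = (\<lambda>(A, u). X closure_of A \<inter> K u) ` (\<A> \<times> UNIV)"

definition cell_unions :: "'a set set" where
  "cell_unions = Union ` {F. finite F \<and> F \<subseteq> cells}"

text \<open>Countability is what lets a diagonal argument produce a single subsequence for all cell
  unions at once.\<close>

lemma countable_cell_unions:
  assumes "countable \<A>"
  shows "countable cell_unions"
  using assms unfolding cell_unions_def cells_def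
  by (intro countable_image countable_Collect_finite_subset) auto

lemma empty_cell_union: "{} \<in> cell_unions"
  unfolding cell_unions_def by force

lemma cell_union_UN:
  assumes "finite I" "\<And>i. i \<in> I \<Longrightarrow> H i \<in> cell_unions"
  shows "(\<Union>i\<in>I. H i) \<in> cell_unions"
proof -
  have "\<exists>F. finite F \<and> F \<subseteq> cells \<and> H i = \<Union>F" if "i \<in> I" for i
    using assms(2)[OF that] unfolding cell_unions_def by auto
  then obtain F where F: "\<And>i. i \<in> I \<Longrightarrow> finite (F i) \<and> F i \<subseteq> cells \<and> H i = \<Union>(F i)"
    by metis
  then have "(\<Union>i\<in>I. H i) = \<Union>(\<Union>i\<in>I. F i)"
    by auto
  moreover have "(\<Union>i\<in>I. F i) \<in> {F. finite F \<and> F \<subseteq> cells}"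
    using F assms(1) by auto
  ultimately show ?thesis
    unfolding cell_unions_def by (rule image_eqI)
qed

lemma cell_union_Un:
  assumes "H \<in> cell_unions" "H' \<in> cell_unions"
  shows "H \<union> H' \<in> cell_unions"
proof -
  have "(\<Union>S\<in>{H, H'}. S) \<in> cell_unions"
    using assms by (intro cell_union_UN) auto
  then show ?thesis
    by simp
qed

lemma compact_cell_union:
  assumes "H \<in> cell_unions"
  shows "compactin X H"
proof -
  obtain F where "finite F" "F \<subseteq> cells" "H = \<Union>F"
    using assms unfolding cell_unions_def by blast
  moreover have "compactin X C" if "C \<in> cells" for C
    using that compact_K unfolding cells_def
    by (auto intro!: closed_Int_compactin)
  ultimately show ?thesis
    by (auto intro!: compactin_Union)
qed

text \<open>Finitely many cells involve finitely many indices, and by monotonicity of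
  \<open>K\<close> the largest of them serves for all.\<close>

lemma cell_union_subset_K:
  assumes "H \<in> cell_unions"
  obtains u where "H \<subseteq> K u"
proof -
  obtain F where F: "finite F" "F \<subseteq> cells" "H = \<Union>F"
    using assms unfolding cell_unions_def by blast
  have "\<exists>u. C \<subseteq> K u" if "C \<in> F" for C
    using F(2) that unfolding cells_def by auto
  then obtain u where u: "\<And>C. C \<in> F \<Longrightarrow> C \<subseteq> K (u C)"
    by metis
  have "C \<subseteq> K (Max (u ` F))" if "C \<in> F" for C
    using u[OF that] incseq_K F(1) that by (meson Max_ge finite_imageI imageI monoD subset_trans)
  then show ?thesis
    using F(3) that by blast
qed

lemma space_\<mu>: "space (\<mu> n) = topspace X"
  using sets_eq_imp_space_eq[OF sets_\<mu>, of n] by (simp add: space_measure_of_conv)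

lemma openin_sets: "openin X U \<Longrightarrow> U \<in> sets (\<mu> n)"
  unfolding sets_\<mu> by (subst sets_measure_of) (auto dest: openin_subset)

lemma closedin_sets:
  assumes "closedin X C"
  shows "C \<in> sets (\<mu> n)"
proof -
  have "space (\<mu> n) - (topspace X - C) \<in> sets (\<mu> n)"
    using assms by (intro sets.Diff sets.top openin_sets) auto
  moreover have "space (\<mu> n) - (topspace X - C) = C"
    using closedin_subset[OF assms] space_\<mu> by auto
  ultimately show ?thesis by simp
qed

lemma compactin_sets: "compactin X C \<Longrightarrow> C \<in> sets (\<mu> n)"
  by (intro closedin_sets compactin_imp_closedin Hausdorff)

lemma cell_union_sets: "H \<in> cell_unions \<Longrightarrow> H \<in> sets (\<mu> n)"
  by (intro compactin_sets compact_cell_union)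

text \<open>By compactness, finitely many base sets whose closures each lie in some
  \<open>G i\<close> cover \<open>H\<close>. Each is assigned to one such index and its closure is
  cut with \<open>K u\<close>, which loses nothing of \<open>H\<close>; pieces with the same index
  are merged. This yields both the subadditivity of \<open>\<beta>\<close> and the covering of
  \<open>K u\<close> by a cell union.\<close>

lemma cell_union_refinement:
  assumes H: "compactin X H" "H \<subseteq> K u"
    and G: "\<And>i :: nat. openin X (G i)" "H \<subseteq> (\<Union>i. G i)"
  obtains N H' where "\<And>i. H' i \<in> cell_unions" "\<And>i. H' i \<subseteq> G i" "H \<subseteq> (\<Union>i<N. H' i)"
proof -
  define \<U> where "\<U> = {A \<in> \<A>. \<exists>i. X closure_of A \<subseteq> G i}"
  have "H \<subseteq> \<Union>\<U>"
  proof
    fix x assume "x \<in> H"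
    then obtain i where "x \<in> G i" "x \<in> K u"
      using H G by blast
    with base[OF G(1)] show "x \<in> \<Union>\<U>"
      unfolding \<U>_def by blast
  qed
  moreover have "\<forall>U\<in>\<U>. openin X U"
    using open_base unfolding \<U>_def by blast
  ultimately obtain \<F> where \<F>: "finite \<F>" "\<F> \<subseteq> \<U>" "H \<subseteq> \<Union>\<F>"
    using H(1) unfolding compactin_def by meson
  have "\<forall>A\<in>\<F>. \<exists>i. X closure_of A \<subseteq> G i"
    using \<F>(2) unfolding \<U>_def by blast
  then obtain i where i: "\<And>A. A \<in> \<F> \<Longrightarrow> X closure_of A \<subseteq> G (i A)"
    by metis
  define H' where "H' j = (\<Union>A\<in>{A \<in> \<F>. i A = j}. X closure_of A \<inter> K u)" for j
  show thesis
  proof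
    show "H' j \<in> cell_unions" for j
      unfolding H'_def cell_unions_def cells_def
      using \<F>(1,2) unfolding \<U>_def
      by (intro image_eqI[OF refl] CollectI conjI finite_imageI) auto
    show "H' j \<subseteq> G j" for j
      using i unfolding H'_def by blast
    \<comment> \<open>\<open>Suc\<close> makes the largest index used fall below the strict bound.
      If \<open>\<F>\<close> is empty then so is \<open>H\<close>, and the unspecified value of
      \<open>Max\<close> does no harm.\<close>
    show "H \<subseteq> (\<Union>j<Suc (Max (i ` \<F>)). H' j)"
    proof
      fix x assume x: "x \<in> H"
      then obtain A where A: "A \<in> \<F>" "x \<in> A"
        using \<F>(3) by blast
      then have "A \<subseteq> X closure_of A"
        using \<F>(2) open_base unfolding \<U>_def by (intro closure_of_subset openin_subset) blast
      then have "x \<in> H' (i A)"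
        using A x H(2) unfolding H'_def by blast
      moreover have "i A < Suc (Max (i ` \<F>))"
        using A(1) \<F>(1) by (simp add: less_Suc_eq_le)
      ultimately show "x \<in> (\<Union>j<Suc (Max (i ` \<F>)). H' j)"
        by blast
    qed
  qed
qed

text \<open>\<open>lim\<close> is unspecified for divergent sequences, so the value is meaningful
  only once convergence is assumed, which the next locale does for cell unions.\<close>

definition \<alpha> :: "'a set \<Rightarrow> ennreal" where
  "\<alpha> H = ennreal (lim (\<lambda>n. measure (\<mu> n) H))"

definition \<beta> :: "'a set \<Rightarrow> ennreal" where
  "\<beta> G = (SUP H\<in>{H \<in> cell_unions. H \<subseteq> G}. \<alpha> H)"

definition \<gamma> :: "'a set \<Rightarrow> ennreal" where
  "\<gamma> S = (INF G\<in>{G. openin X G \<and> S \<subseteq> G}. \<beta> G)"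

lemma \<alpha>_le_\<beta>: "H \<in> cell_unions \<Longrightarrow> H \<subseteq> G \<Longrightarrow> \<alpha> H \<le> \<beta> G"
  unfolding \<beta>_def by (rule SUP_upper) simp

lemma \<beta>_mono: "G \<subseteq> G' \<Longrightarrow> \<beta> G \<le> \<beta> G'"
  unfolding \<beta>_def by (rule SUP_subset_mono) auto

lemma \<gamma>_le_\<beta>: "openin X G \<Longrightarrow> S \<subseteq> G \<Longrightarrow> \<gamma> S \<le> \<beta> G"
  unfolding \<gamma>_def by (rule INF_lower) simp

lemma \<gamma>_mono: "S \<subseteq> S' \<Longrightarrow> \<gamma> S \<le> \<gamma> S'"
  unfolding \<gamma>_def by (rule INF_superset_mono) auto

lemma \<gamma>_open: "openin X G \<Longrightarrow> \<gamma> G = \<beta> G"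
  unfolding \<gamma>_def by (intro antisym INF_lower INF_greatest \<beta>_mono) auto

end

section \<open>Limits on cell unions and inner approximation of open sets\<close>

locale convergent_exhausted_sequence = exhausted_sequence +
  assumes convergent: "\<And>H. H \<in> cell_unions \<Longrightarrow> convergent (\<lambda>n. measure (\<mu> n) H)"
    and tight: "\<And>e. e > 0 \<Longrightarrow> \<exists>u. \<forall>n. measure (\<mu> n) (K u) > 1 - e"
begin

lemma tendsto_\<alpha>:
  assumes "H \<in> cell_unions"
  shows "(\<lambda>n. emeasure (\<mu> n) H) \<longlonglongrightarrow> \<alpha> H"
proof -
  interpret prob_space "\<mu> n" for n by (rule prob_space_\<mu>)
  show ?thesis
    using convergent[OF assms] unfolding \<alpha>_def emeasure_eq_measure
    by (intro tendsto_ennrealI) (simp add: convergent_LIMSEQ_iff)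
qed

lemma \<alpha>_mono:
  assumes "H \<in> cell_unions" "H' \<in> cell_unions" "H \<subseteq> H'"
  shows "\<alpha> H \<le> \<alpha> H'"
  using assms by (intro LIMSEQ_le[OF tendsto_\<alpha> tendsto_\<alpha>]) (auto intro!: emeasure_mono cell_union_sets)

lemma \<alpha>_le_1:
  assumes "H \<in> cell_unions"
  shows "\<alpha> H \<le> 1"
proof -
  interpret prob_space "\<mu> n" for n by (rule prob_space_\<mu>)
  show ?thesis
    using assms by (intro LIMSEQ_le_const2[OF tendsto_\<alpha>]) (auto intro: measure_le_1)
qed

lemma \<alpha>_Un_disjoint:
  assumes "H \<in> cell_unions" "H' \<in> cell_unions" "H \<inter> H' = {}"
  shows "\<alpha> (H \<union> H') = \<alpha> H + \<alpha> H'"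
proof (rule LIMSEQ_unique)
  show "(\<lambda>n. emeasure (\<mu> n) (H \<union> H')) \<longlonglongrightarrow> \<alpha> (H \<union> H')"
    using assms by (intro tendsto_\<alpha> cell_union_Un)
  have "(\<lambda>n. emeasure (\<mu> n) H + emeasure (\<mu> n) H') \<longlonglongrightarrow> \<alpha> H + \<alpha> H'"
    using assms by (intro tendsto_add tendsto_\<alpha>)
  then show "(\<lambda>n. emeasure (\<mu> n) (H \<union> H')) \<longlonglongrightarrow> \<alpha> H + \<alpha> H'"
    using assms by (simp add: plus_emeasure cell_union_sets)
qed

lemma \<alpha>_UN_le:
  assumes "\<And>i. H i \<in> cell_unions"
  shows "\<alpha> (\<Union>i<N. H i) \<le> (\<Sum>i<(N::nat). \<alpha> (H i))"
proof (rule LIMSEQ_le)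
  show "(\<lambda>n. emeasure (\<mu> n) (\<Union>i<N. H i)) \<longlonglongrightarrow> \<alpha> (\<Union>i<N. H i)"
    using assms by (intro tendsto_\<alpha> cell_union_UN) auto
  show "(\<lambda>n. \<Sum>i<N. emeasure (\<mu> n) (H i)) \<longlonglongrightarrow> (\<Sum>i<N. \<alpha> (H i))"
    using assms by (intro tendsto_sum tendsto_\<alpha>)
  show "\<exists>M. \<forall>n\<ge>M. emeasure (\<mu> n) (\<Union>i<N. H i) \<le> (\<Sum>i<N. emeasure (\<mu> n) (H i))"
    using assms by (auto intro!: emeasure_subadditive_finite cell_union_sets)
qed

text \<open>A cell union \<open>H\<close> inside the union of the \<open>G i\<close> is covered by
  finitely many cell unions, each inside one \<open>G i\<close>, so the finite subadditivity of
  \<open>\<alpha>\<close> suffices.\<close>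

lemma \<beta>_UN_le:
  assumes "\<And>i :: nat. openin X (G i)"
  shows "\<beta> (\<Union>i. G i) \<le> (\<Sum>i. \<beta> (G i))"
  unfolding \<beta>_def[of "\<Union>i. G i"]
proof (rule SUP_least, clarify)
  fix H assume H: "H \<in> cell_unions" "H \<subseteq> (\<Union>i. G i)"
  obtain u where u: "H \<subseteq> K u"
    using H(1) by (rule cell_union_subset_K)
  obtain N H' where H': "\<And>i. H' i \<in> cell_unions" "\<And>i. H' i \<subseteq> G i" "H \<subseteq> (\<Union>i<N. H' i)"
    by (rule cell_union_refinement[OF compact_cell_union[OF H(1)] u assms H(2)]) (rule that)
  have "\<alpha> H \<le> \<alpha> (\<Union>i<N. H' i)"
    using H H' by (intro \<alpha>_mono cell_union_UN) auto
  also have "\<dots> \<le> (\<Sum>i<N. \<alpha> (H' i))"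
    using H'(1) by (rule \<alpha>_UN_le)
  also have "\<dots> \<le> (\<Sum>i<N. \<beta> (G i))"
    using H' by (intro sum_mono \<alpha>_le_\<beta>)
  also have "\<dots> \<le> (\<Sum>i. \<beta> (G i))"
    by (intro sum_le_suminf) auto
  finally show "\<alpha> H \<le> (\<Sum>i. \<beta> (G i))" .
qed

section \<open>The outer measure \<gamma> and its measurable sets\<close>

lemma \<gamma>_empty: "\<gamma> {} = 0"
proof -
  have "\<alpha> {} = 0"
    using LIMSEQ_unique[OF tendsto_\<alpha>[OF empty_cell_union], of 0] by simp
  then have "\<beta> {} = 0"
    using empty_cell_union unfolding \<beta>_def by (auto intro!: antisym SUP_least)
  then show ?thesis
    using \<gamma>_open[of "{}"] by simp
qed

text \<open>Each \<open>S i\<close> is enclosed in an open set with error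
  \<open>e * (1/2)^Suc i\<close>; the errors add up to \<open>e\<close>, and subadditivity of
  \<open>\<beta>\<close> on open sets does the rest.\<close>

lemma \<gamma>_UN_le:
  assumes "\<And>i :: nat. S i \<subseteq> topspace X"
  shows "\<gamma> (\<Union>i. S i) \<le> (\<Sum>i. \<gamma> (S i))"
proof (rule ennreal_le_epsilon)
  fix e :: real assume fin: "(\<Sum>i. \<gamma> (S i)) < top" and e: "0 < e"
  have "\<exists>G. openin X G \<and> S i \<subseteq> G \<and> \<beta> G \<le> \<gamma> (S i) + ennreal (e * (1/2)^Suc i)" for i
  proof -
    have "\<gamma> (S i) < top"
      using fin by (meson ennreal_suminf_lessD)
    \<comment> \<open>Adding a positive amount gives a strictly larger value only because
      \<open>\<gamma> (S i)\<close> is finite. Strictness then yields an open set from the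
      infimum.\<close>
    then have "\<gamma> (S i) < \<gamma> (S i) + ennreal (e * (1/2)^Suc i)"
      using ennreal_add_left_cancel_less[of "\<gamma> (S i)" 0 "ennreal (e * (1/2)^Suc i)"] e by simp
    then show ?thesis
      unfolding \<gamma>_def[of "S i"] INF_less_iff by (auto intro: less_imp_le)
  qed
  then obtain G where G: "\<And>i. openin X (G i)" "\<And>i. S i \<subseteq> G i"
      "\<And>i. \<beta> (G i) \<le> \<gamma> (S i) + ennreal (e * (1/2)^Suc i)"
    by metis
  have "\<gamma> (\<Union>i. S i) \<le> \<beta> (\<Union>i. G i)"
    using G(1,2) by (intro \<gamma>_le_\<beta> UN_mono openin_Union) auto
  also have "\<dots> \<le> (\<Sum>i. \<beta> (G i))"
    using G(1) by (rule \<beta>_UN_le)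
  also have "\<dots> \<le> (\<Sum>i. \<gamma> (S i) + ennreal (e * (1/2)^Suc i))"
    using G(3) by (intro suminf_le) auto
  also have "\<dots> = (\<Sum>i. \<gamma> (S i)) + (\<Sum>i. ennreal (e * (1/2)^Suc i))"
    by (intro suminf_add[symmetric]) auto
  also have "(\<Sum>i. ennreal (e * (1/2)^Suc i)) = ennreal e"
    using sums_mult[OF power_half_series, of e] e by (intro suminf_ennreal_eq) auto
  finally show "\<gamma> (\<Union>i. S i) \<le> (\<Sum>i. \<gamma> (S i)) + ennreal e" .
qed

lemma outer_measure_space_\<gamma>: "outer_measure_space (Pow (topspace X)) \<gamma>"
  unfolding outer_measure_space_def positive_def increasing_def countably_subadditive_def
  using \<gamma>_empty by (auto intro!: \<gamma>_mono \<gamma>_UN_le)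

text \<open>The open set \<open>G - F\<close> is exhausted from inside by cell unions
  \<open>H\<close>. Such an \<open>H\<close> is closed, so \<open>G - H\<close> is open; it contains
  \<open>F \<inter> G\<close> and is exhausted by cell unions \<open>H'\<close> disjoint from
  \<open>H\<close>. Additivity of \<open>\<alpha>\<close> on
  \<open>H' \<union> H \<subseteq> G\<close> gives the bound, and two suprema finish it.\<close>

lemma \<gamma>_Int_closed:
  assumes F: "closedin X F" and G: "openin X G"
  shows "\<gamma> (F \<inter> G) + \<gamma> (G - F) \<le> \<beta> G"
proof -
  have open_diff: "openin X (G - C)" if "closedin X C" for C
    using G that by (rule openin_diff)
  have *: "\<gamma> (F \<inter> G) + \<alpha> H \<le> \<beta> G" if H: "H \<in> cell_unions" "H \<subseteq> G - F" for H
  proof -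
    have "\<gamma> (F \<inter> G) \<le> \<beta> (G - H)"
      using H by (intro \<gamma>_le_\<beta> open_diff compactin_imp_closedin Hausdorff compact_cell_union) auto
    then have "\<gamma> (F \<inter> G) + \<alpha> H \<le> \<beta> (G - H) + \<alpha> H"
      by (rule add_right_mono)
    \<comment> \<open>A constant moves into a supremum only over a nonempty family; the empty cell
      union guarantees this here and in the later suprema.\<close>
    also have "\<dots> = (SUP H'\<in>{H' \<in> cell_unions. H' \<subseteq> G - H}. \<alpha> H' + \<alpha> H)"
      unfolding \<beta>_def using empty_cell_union by (intro ennreal_SUP_add_left[symmetric]) auto
    also have "\<dots> \<le> \<beta> G"
    proof (rule SUP_least, clarify)
      fix H' assume H': "H' \<in> cell_unions" "H' \<subseteq> G - H"
      then have "\<alpha> H' + \<alpha> H = \<alpha> (H' \<union> H)"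
        using H by (intro \<alpha>_Un_disjoint[symmetric]) auto
      also have "\<dots> \<le> \<beta> G"
        using H H' by (intro \<alpha>_le_\<beta> cell_union_Un) auto
      finally show "\<alpha> H' + \<alpha> H \<le> \<beta> G" .
    qed
    finally show ?thesis .
  qed
  have "\<gamma> (F \<inter> G) + \<gamma> (G - F) = (SUP H\<in>{H \<in> cell_unions. H \<subseteq> G - F}. \<gamma> (F \<inter> G) + \<alpha> H)"
    unfolding \<gamma>_open[OF open_diff[OF F]] \<beta>_def
    using empty_cell_union by (intro ennreal_SUP_add_right) auto
  also have "\<dots> \<le> \<beta> G"
    using * by (intro SUP_least) auto
  finally show ?thesis .
qed

text \<open>Since \<open>\<gamma> S\<close> is an infimum over open supersets, one inequality
  reduces to open test sets. The other is countable subadditivity for a sequence that is empty after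
  two terms.\<close>

lemma closedin_lambda_system:
  assumes F: "closedin X F"
  shows "F \<in> lambda_system (topspace X) (Pow (topspace X)) \<gamma>"
proof -
  have "\<gamma> (F \<inter> S) + \<gamma> ((topspace X - F) \<inter> S) = \<gamma> S" if S: "S \<subseteq> topspace X" for S
  proof (rule antisym)
    show "\<gamma> (F \<inter> S) + \<gamma> ((topspace X - F) \<inter> S) \<le> \<gamma> S"
      unfolding \<gamma>_def[of S]
    proof (rule INF_greatest, clarify)
      fix G assume G: "openin X G" "S \<subseteq> G"
      then have "\<gamma> (F \<inter> S) + \<gamma> ((topspace X - F) \<inter> S) \<le> \<gamma> (F \<inter> G) + \<gamma> (G - F)"
        by (intro add_mono \<gamma>_mono) auto
      also have "\<dots> \<le> \<beta> G"
        using F G(1) by (rule \<gamma>_Int_closed)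
      finally show "\<gamma> (F \<inter> S) + \<gamma> ((topspace X - F) \<inter> S) \<le> \<beta> G" .
    qed
    have "\<gamma> S = \<gamma> (\<Union>i. binaryset (F \<inter> S) ((topspace X - F) \<inter> S) i)"
      using S by (intro arg_cong[of _ _ \<gamma>]) (auto simp: UN_binaryset_eq)
    also have "\<dots> \<le> (\<Sum>i. \<gamma> (binaryset (F \<inter> S) ((topspace X - F) \<inter> S) i))"
      using S by (intro \<gamma>_UN_le) (auto simp: binaryset_def)
    also have "\<dots> = \<gamma> (F \<inter> S) + \<gamma> ((topspace X - F) \<inter> S)"
      by (intro suminf_binaryset_eq \<gamma>_empty)
    finally show "\<gamma> S \<le> \<gamma> (F \<inter> S) + \<gamma> ((topspace X - F) \<inter> S)" .
  qed
  then show ?thesis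
    using closedin_subset[OF F] unfolding lambda_system_def by auto
qed

section \<open>The limit measure and weak convergence\<close>

definition \<nu> :: "'a measure" where
  "\<nu> = measure_of (topspace X) {U. openin X U} \<gamma>"

lemma sets_\<nu>: "sets \<nu> = sets (sigma (topspace X) {U. openin X U})"
  unfolding \<nu>_def by (simp add: sets_measure_of_conv)

lemma space_\<nu>: "space \<nu> = topspace X"
  unfolding \<nu>_def by (simp add: space_measure_of_conv)

lemma openin_sets_\<nu>: "openin X U \<Longrightarrow> U \<in> sets \<nu>"
  using openin_sets sets_\<mu> sets_\<nu> by blast

text \<open>\<open>measure_of\<close> takes over the values of \<open>\<gamma>\<close> only if they
  form a measure on the generated sigma-algebra. Caratheodory provides a measure on
  \<open>lambda_system\<close>, which contains the open sets as complements of closed ones, hence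
  all Borel sets.\<close>

lemma emeasure_\<nu>:
  assumes "S \<in> sets \<nu>"
  shows "emeasure \<nu> S = \<gamma> S"
proof -
  let ?L = "lambda_system (topspace X) (Pow (topspace X)) \<gamma>"
  have L: "measure_space (topspace X) ?L \<gamma>"
    by (intro sigma_algebra.caratheodory_lemma sigma_algebra_Pow outer_measure_space_\<gamma>)
  then interpret L: sigma_algebra "topspace X" ?L
    unfolding measure_space_def by blast
  have subset: "{U. openin X U} \<subseteq> Pow (topspace X)"
    by (auto dest: openin_subset)
  have "{U. openin X U} \<subseteq> ?L"
  proof clarify
    fix U assume U: "openin X U"
    then have "topspace X - (topspace X - U) \<in> ?L"
      by (intro L.compl_sets closedin_lambda_system) blast
    then show "U \<in> ?L"
      using openin_subset[OF U] by (simp add: double_diff)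
  qed
  then have "sigma_sets (topspace X) {U. openin X U} \<subseteq> ?L"
    by (rule L.sigma_sets_subset)
  then have "measure_space (topspace X) (sigma_sets (topspace X) {U. openin X U}) \<gamma>"
    using L subset by (intro measure_down[OF L] sigma_algebra_sigma_sets)
  then have "positive (sets \<nu>) \<gamma>" "countably_additive (sets \<nu>) \<gamma>"
    unfolding measure_space_def sets_\<nu> using subset by simp_all
  then show ?thesis
    using assms subset by (intro emeasure_measure_of[OF \<nu>_def])
qed

lemma emeasure_\<nu>_open: "openin X G \<Longrightarrow> emeasure \<nu> G = \<beta> G"
  by (simp add: emeasure_\<nu> openin_sets_\<nu> \<gamma>_open)

text \<open>Tightness prevents the loss of mass in the limit. As \<open>K u\<close> need not be a
  cell union, it is first covered by one, whose measures exceed \<open>1 - e\<close> for all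
  \<open>n\<close> and converge.\<close>

lemma prob_space_\<nu>: "prob_space \<nu>"
proof (rule prob_spaceI, rule antisym)
  have \<nu>: "emeasure \<nu> (space \<nu>) = \<beta> (topspace X)"
    by (simp add: space_\<nu> emeasure_\<nu>_open)
  show "emeasure \<nu> (space \<nu>) \<le> 1"
    unfolding \<nu> \<beta>_def by (intro SUP_least \<alpha>_le_1) auto
  show "1 \<le> emeasure \<nu> (space \<nu>)"
  proof (rule ennreal_le_epsilon)
    fix e :: real assume "0 < e"
    then obtain u where u: "\<And>n. measure (\<mu> n) (K u) > 1 - e"
      using tight by blast
    \<comment> \<open>With a constant sequence of open sets the refinement lemma becomes a plain
      covering statement.\<close>
    have "K u \<subseteq> (\<Union>i :: nat. topspace X)"
      using compactin_subset_topspace[OF compact_K] by simp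
    then obtain N H where H: "\<And>i. H i \<in> cell_unions" "K u \<subseteq> (\<Union>i<N::nat. H i)"
      using cell_union_refinement[OF compact_K subset_refl, of "\<lambda>_. topspace X" u]
      by (metis openin_topspace)
    have UN: "(\<Union>i<N. H i) \<in> cell_unions"
      using H(1) by (intro cell_union_UN) auto
    have "1 \<le> emeasure (\<mu> n) (\<Union>i<N. H i) + ennreal e" for n
    proof -
      interpret prob_space "\<mu> n" by (rule prob_space_\<mu>)
      have "measure (\<mu> n) (K u) \<le> measure (\<mu> n) (\<Union>i<N. H i)"
        using H UN by (intro finite_measure_mono cell_union_sets)
      then have "1 \<le> measure (\<mu> n) (\<Union>i<N. H i) + e"
        using u[of n] by linarith
      then show ?thesis
        using \<open>0 < e\<close> by (simp add: emeasure_eq_measure flip: ennreal_plus)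
    qed
    then have "1 \<le> \<alpha> (\<Union>i<N. H i) + ennreal e"
      by (intro LIMSEQ_le_const[OF tendsto_add[OF tendsto_\<alpha>[OF UN] tendsto_const]]) auto
    also have "\<dots> \<le> \<beta> (topspace X) + ennreal e"
      using UN by (intro add_right_mono \<alpha>_le_\<beta> compactin_subset_topspace compact_cell_union)
    finally show "1 \<le> emeasure \<nu> (space \<nu>) + ennreal e"
      unfolding \<nu> .
  qed
qed

text \<open>A cell union \<open>H\<close> in the complement of \<open>C\<close> satisfies
  \<open>\<mu> n C + \<mu> n H \<le> 1\<close> (as measures). Passing to the limsup and then to the
  supremum over \<open>H\<close> bounds the limsup plus the \<open>\<nu>\<close>-measure of the
  complement by 1.\<close>

lemma limsup_closed_le:
  assumes C: "closedin X C"
  shows "limsup (\<lambda>n. emeasure (\<mu> n) C) \<le> emeasure \<nu> C"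
proof -
  interpret \<nu>: prob_space \<nu> by (rule prob_space_\<nu>)
  let ?L = "limsup (\<lambda>n. emeasure (\<mu> n) C)"
  have U: "openin X (topspace X - C)"
    using C by blast
  have "?L + \<alpha> H \<le> 1" if H: "H \<in> cell_unions" "H \<subseteq> topspace X - C" for H
  proof -
    have "emeasure (\<mu> n) C + emeasure (\<mu> n) H \<le> 1" for n
    proof -
      interpret prob_space "\<mu> n" by (rule prob_space_\<mu>)
      have "emeasure (\<mu> n) C + emeasure (\<mu> n) H = emeasure (\<mu> n) (C \<union> H)"
        using H by (intro plus_emeasure closedin_sets C cell_union_sets) auto
      then show ?thesis
        by (simp add: measure_le_1)
    qed
    \<comment> \<open>Isolating \<open>C\<close> leaves on the right a sequence with a genuine
      limit. The truncated subtraction can be undone afterwards because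
      \<open>\<alpha> H \<le> 1\<close>.\<close>
    then have "?L \<le> limsup (\<lambda>n. 1 - emeasure (\<mu> n) H)"
      by (intro Limsup_mono always_eventually allI) (simp add: ennreal_le_minus_iff add.commute)
    also have "\<dots> = 1 - \<alpha> H"
    proof (rule lim_imp_Limsup)
      have "\<alpha> H \<noteq> top"
        using \<alpha>_le_1[OF H(1)] by (auto simp: top_unique)
      then show "(\<lambda>n. 1 - emeasure (\<mu> n) H) \<longlonglongrightarrow> 1 - \<alpha> H"
        by (intro tendsto_diff_ennreal tendsto_const tendsto_\<alpha> H(1)) auto
    qed simp
    finally have "?L + \<alpha> H \<le> 1 - \<alpha> H + \<alpha> H"
      by (rule add_right_mono)
    then show ?thesis
      using \<alpha>_le_1[OF H(1)] by (simp add: diff_add_cancel_ennreal)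
  qed
  then have "(SUP H\<in>{H \<in> cell_unions. H \<subseteq> topspace X - C}. ?L + \<alpha> H) \<le> 1"
    by (intro SUP_least) auto
  then have "?L + \<beta> (topspace X - C) \<le> 1"
    unfolding \<beta>_def using empty_cell_union by (subst ennreal_SUP_add_right) auto
  also have "1 = emeasure \<nu> (C \<union> (topspace X - C))"
    using \<nu>.emeasure_space_1 closedin_subset[OF C] by (simp add: space_\<nu> Un_absorb1)
  also have "\<dots> = emeasure \<nu> C + emeasure \<nu> (topspace X - C)"
    using closedin_sets[OF C] U by (intro plus_emeasure[symmetric]) (auto simp: sets_\<nu> sets_\<mu> openin_sets_\<nu>)
  \<comment> \<open>The common summand \<open>\<beta> (topspace X - C)\<close> is a value of the
    probability measure \<open>\<nu>\<close>, so it is finite and can be cancelled.\<close>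
  finally show ?thesis
    using \<nu>.emeasure_finite[of "topspace X - C"]
    by (simp add: emeasure_\<nu>_open[OF U] ennreal_add_left_cancel_le add.commute[of _ "\<beta> _"])
qed

end

section \<open>Metric spaces: the countable base and the subsequence\<close>

context Metric_space
begin

text \<open>Compact sets are totally bounded, so for every \<open>u\<close> and every radius
  \<open>inverse (Suc m)\<close> finitely many balls cover \<open>K u\<close>. The space may be
  inseparable, which is why the base property is restricted to points of the
  \<open>K u\<close>.\<close>

lemma countable_base_on_compact_sets:
  assumes K: "\<And>u :: nat. compactin mtopology (K u)"
  obtains \<A> where "countable \<A>" "\<And>A. A \<in> \<A> \<Longrightarrow> openin mtopology A"
    "\<And>G x u. openin mtopology G \<Longrightarrow> x \<in> G \<Longrightarrow> x \<in> K u \<Longrightarrow>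
      \<exists>A\<in>\<A>. x \<in> A \<and> mtopology closure_of A \<subseteq> G"
proof -
  have "\<forall>u m. \<exists>F. finite F \<and> F \<subseteq> K u \<and> K u \<subseteq> (\<Union>y\<in>F. mball y (inverse (real (Suc m))))"
    using compactin_imp_mtotally_bounded[OF K] unfolding mtotally_bounded_def by simp
  then obtain F where F: "\<And>u m. finite (F u m)"
      "\<And>u m. K u \<subseteq> (\<Union>y\<in>F u m. mball y (inverse (real (Suc m))))"
    by metis
  define \<A> where "\<A> = (\<Union>u m. (\<lambda>y. mball y (inverse (real (Suc m)))) ` F u m)"
  show thesis
  proof
    show "countable \<A>"
      unfolding \<A>_def using F(1) using F(1) by (auto intro!: countable_UN countable_image intro: countable_finite)
    show "openin mtopology A" if "A \<in> \<A>" for A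
      using that unfolding \<A>_def by auto
    fix G x u assume G: "openin mtopology G" "x \<in> G" and x: "x \<in> K u"
    obtain e where e: "0 < e" "mball x e \<subseteq> G"
      using G openin_mtopology by blast
    \<comment> \<open>Every point of the closed ball around \<open>y\<close> is within
      \<open>e / 2\<close> of \<open>y\<close>, and so is \<open>x\<close>; the triangle inequality
      then keeps that ball inside \<open>mball x e\<close>.\<close>
    obtain m where m: "inverse (real (Suc m)) < e / 2"
      using reals_Archimedean[of "e / 2"] e(1) by auto
    obtain y where y: "y \<in> F u m" "x \<in> mball y (inverse (real (Suc m)))"
      using F(2) x by blast
    have "mtopology closure_of mball y (inverse (real (Suc m))) \<subseteq> mcball y (inverse (real (Suc m)))"
      by (intro closure_of_minimal mball_subset_mcball closedin_mcball)
    also have "\<dots> \<subseteq> mball x e"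
    proof
      fix z assume "z \<in> mcball y (inverse (real (Suc m)))"
      then show "z \<in> mball x e"
        using y(2) m triangle[of x y z] by (auto simp: commute)
    qed
    finally show "\<exists>A\<in>\<A>. x \<in> A \<and> mtopology closure_of A \<subseteq> G"
      using y e(2) unfolding \<A>_def by blast
  qed
qed

theorem Prokhorov_convergent_subsequence:
  assumes prob: "\<And>n :: nat. prob_space (\<mu> n)"
    and sets: "\<And>n. sets (\<mu> n) = sets (sigma M {U. openin mtopology U})"
    and tight: "\<And>e. e > 0 \<Longrightarrow> \<exists>K. compactin mtopology K \<and> (\<forall>n. measure (\<mu> n) K > 1 - e)"
  obtains r \<nu> where "strict_mono r" "prob_space \<nu>" "sets \<nu> = sets (sigma M {U. openin mtopology U})"
    "\<And>C. closedin mtopology C \<Longrightarrow> limsup (\<lambda>n. emeasure (\<mu> (r n)) C) \<le> emeasure \<nu> C"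
proof -
  have "\<forall>u :: nat. \<exists>K. compactin mtopology K \<and> (\<forall>n. measure (\<mu> n) K > 1 - inverse (Suc u))"
    using tight by simp
  then obtain K0 where K0: "\<And>u :: nat. compactin mtopology (K0 u)"
      "\<And>u n. measure (\<mu> n) (K0 u) > 1 - inverse (Suc u)"
    by metis
  \<comment> \<open>Finite unions make the family increasing, keep it compact and only enlarge the
    measures.\<close>
  define K where "K u = (\<Union>v\<le>u. K0 v)" for u
  have compact_K: "compactin mtopology (K u)" for u
    unfolding K_def using K0(1) by (intro compactin_Union) auto
  have "incseq K"
    unfolding K_def by (force simp: incseq_def)
  obtain \<A> where \<A>: "countable \<A>" "\<And>A. A \<in> \<A> \<Longrightarrow> openin mtopology A"
    "\<And>G x u. openin mtopology G \<Longrightarrow> x \<in> G \<Longrightarrow> x \<in> K u \<Longrightarrow>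
      \<exists>A\<in>\<A>. x \<in> A \<and> mtopology closure_of A \<subseteq> G"
    by (rule countable_base_on_compact_sets[of K, OF compact_K]) (rule that)
  \<comment> \<open>Generality in \<open>r\<close> serves twice: \<open>id\<close> makes
    \<open>cell_unions\<close> available for choosing the subsequence, and the chosen
    \<open>r\<close> is used afterwards. The cell unions depend only on the topology,
    \<open>\<A>\<close> and \<open>K\<close>, so they are the same both times.\<close>
  have exhausted: "exhausted_sequence mtopology \<A> K (\<mu> \<circ> r)" for r
    by (rule exhausted_sequence.intro[OF Hausdorff_space_mtopology \<A>(2,3) compact_K \<open>incseq K\<close>])
      (simp_all add: prob sets)
  interpret exhausted_sequence mtopology \<A> K \<mu>
    using exhausted[of id] by simp
  have "norm (measure (\<mu> n) H) \<le> 1" for n H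
    using prob_space.prob_le_1[OF prob] by simp
  \<comment> \<open>The measures are regarded as functions on the countable set
    \<open>cell_unions\<close>, bounded by 1; the diagonal argument gives pointwise convergence
    there.\<close>
  then obtain r where r: "strict_mono r"
    "\<And>H. H \<in> cell_unions \<Longrightarrow> \<exists>l. (\<lambda>n. measure (\<mu> (r n)) H) \<longlonglongrightarrow> l"
    using function_convergent_subsequence[OF countable_cell_unions[OF \<A>(1)],
        of "\<lambda>n. measure (\<mu> n)" 1] by metis
  have tight_K: "\<exists>u. \<forall>n. measure (\<mu> n) (K u) > 1 - e" if e: "e > 0" for e
  proof -
    obtain u where u: "inverse (real (Suc u)) < e"
      using reals_Archimedean[OF e] by blast
    have "measure (\<mu> n) (K u) > 1 - e" for n
    proof -
      interpret prob_space "\<mu> n" by (rule prob)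
      have "measure (\<mu> n) (K0 u) \<le> measure (\<mu> n) (K u)"
        by (intro finite_measure_mono compactin_sets compact_K) (auto simp: K_def)
      then show ?thesis
        using K0(2)[of u n] u by linarith
    qed
    then show ?thesis by blast
  qed
  interpret lim: convergent_exhausted_sequence mtopology \<A> K "\<mu> \<circ> r"
  proof (intro convergent_exhausted_sequence.intro convergent_exhausted_sequence_axioms.intro)
    show "\<exists>u. \<forall>n. measure ((\<mu> \<circ> r) n) (K u) > 1 - e" if "e > 0" for e
      using tight_K[OF that] by auto
  qed (use r(2) exhausted in \<open>auto simp: convergent_def\<close>)
  show thesis
  proof
    show "strict_mono r" by (rule r(1))
    show "prob_space lim.\<nu>" by (rule lim.prob_space_\<nu>)
    show "sets lim.\<nu> = sets (sigma M {U. openin mtopology U})"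
      using lim.sets_\<nu> by simp
    show "limsup (\<lambda>n. emeasure (\<mu> (r n)) C) \<le> emeasure lim.\<nu> C" if "closedin mtopology C" for C
      using lim.limsup_closed_le[OF that] by simp
  qed
qed

end

theorem theorem2p11:
  fixes T :: "real set"
    and \<tau> :: "(real \<Rightarrow> real) metric"
    and \<mu> :: "nat \<Rightarrow> (real \<Rightarrow> real) measure"
  assumes "countable T" and "T \<subseteq> {0..1}" and "{0..1} \<subseteq> closure T"
    and "regular_metric T \<tau>"
    and "\<And>n. \<mu> n \<in> borel_prob_measures \<tau>"
    and "tight_sequence \<tau> \<mu>"
  shows "\<exists>r \<nu>. strict_mono r \<and> \<nu> \<in> borel_prob_measures \<tau> \<and> weakly_converges \<tau> (\<mu> \<circ> r) \<nu>"
proof -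
  \<comment> \<open>Under this interpretation \<open>mtopology_of \<tau>\<close> unfolds to
    \<open>mtopology\<close>, so the Borel sets, tightness and weak convergence for
    \<open>\<tau>\<close> become those of the metric-space theorem.\<close>
  interpret Metric_space "mspace \<tau>" "mdist \<tau>"
    by (rule Metric_space_mspace_mdist)
  obtain r \<nu> where "strict_mono r" "prob_space \<nu>"
    "sets \<nu> = sets (sigma (mspace \<tau>) {U. openin mtopology U})"
    "\<And>C. closedin mtopology C \<Longrightarrow> limsup (\<lambda>n. emeasure (\<mu> (r n)) C) \<le> emeasure \<nu> C"
    using assms(5,6) Prokhorov_convergent_subsequence[of \<mu>]
    unfolding borel_prob_measures_def borel_measure_of_def tight_sequence_def mtopology_of_def
    by blast
  then have "strict_mono r \<and> \<nu> \<in> borel_prob_measures \<tau> \<and> weakly_converges \<tau> (\<mu> \<circ> r) \<nu>"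
    unfolding borel_prob_measures_def borel_measure_of_def weakly_converges_def mtopology_of_def
    by simp
  then show ?thesis
    by blast
qed

end
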